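(* Let $\bar c$ be an integer and let $c$ be the actual number of compromised sensors, with $c\le\bar c<s/2$. Let $\tilde f=f^{(s-\bar c)}$ be the voting rule with parameter $r=s-\bar c$. Then for every admissible attack $g$ (compromising $c$ sensors), $$\gamma(\tilde f,g)\ge (s-\bar c-c)\,I,$$ where $I=\min\{I_0,I_1\}$.
   Context: A binary state $\theta\in\{0,1\}$ is observed by $s$ sensors indexed by $\mathcal{S}=\{1,\dots,s\}$; at each time $k\in\mathbb{Z}^+$ sensor $i$ produces a real observation $x_i(k)$. Let $\mu,\nu$ be mutually absolutely continuous Borel probability measures on $\mathbb{R}$. Under $\mathbb{P}_\theta$ all $x_i(k)$ are independent, with law $\nu$ if $\theta=0$ and $\mu$ if $\theta=1$. Let $I_1=\int\log\frac{d\mu}{d\nu}\,d\mu$, $I_0=-\int\log\frac{d\mu}{d\nu}\,d\nu$, assumed $0<I_0,I_1<\infty$, and $I=\min\{I_0,I_1\}$. Attack model: an attacker compromises a fixed set $\mathcal{C}\subseteq\mathcal{S}$ with $|\mathcal{C}|=c$; the detector does not know $\mathcal{C}$ or $c$, only the upper bound $\bar c$. The fusion center receives $x'(k)=x(k)+x^a(k)$, where $x^a(k)\in\mathbb{R}^s$, the union over $k$ of the supports of $x^a(k)$ equals $\mathcal{C}$, and $x^a(k)=g(X_{\mathcal{C}}(k),X^a(k-1),\theta,k)$ is a measurable (possibly randomized) function of the true observations of the compromised sensors up to time $k$, the previously injected vectors, the true state $\theta$, and $k$. Such $g$ is an admissible attack; $\mathbb{P}^g_\theta,\mathbb{E}^g_\theta$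 denote probability and expectation of the manipulated observations. A detection strategy is $f=(f_1,f_2,\dots)$ with $f_k$ mapping $x'(1),\dots,x'(k)$ to $\{\text{continue},0,1\}$; stopping time $T$ is the first $k$ with $f_k\neq\text{continue}$, decision $f_T$. With $\alpha=\mathbb{P}^g_0[f_T=1]$, $\beta=\mathbb{P}^g_1[f_T=0]$, $D(T)=\max_\theta\mathbb{E}^g_\theta[T]$, the performance is $\gamma(f,g)=\lim_{\alpha=\beta\to0^+}\frac{\log(1/\alpha)}{D(T)}$, the limit taken along the family of tests for which $\alpha=\beta\to0$. Voting rule $f^{(r)}$ ($s/2<r\le s$): with $S_i(n)=\sum_{k=1}^n\log\frac{d\mu}{d\nu}(x'_i(k))$, thresholds $a=b>0$ (tending to $\infty$), $\tau^+_i(b)=\inf\{k:S_i(k)\ge b\}$, $\tau^-_i(a)=\inf\{k:S_i(k)\le -a\}$, and $\tau^\pm_{(j)}$ the $j$-th smallest of these over $i$; the rule stops at $\min\{\tau^-_{(r)}(a),\tau^+_{(r)}(b)\}$, deciding $0$ if $\tau^-_{(r)}(a)<\tau^+_{(r)}(b)$, $1$ if $\tau^+_{(r)}(b)<\tau^-_{(r)}(a)$, and $0$ or $1$ with probability $1/2$ each if equal. *)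

theory Defs
  imports "HOL-Probability.Probability"
begin

text \<open>L plays the role of log (d mu / d nu): mu has density exp o L w.r.t. nu
 (hence mu and nu are mutually absolutely continuous).\<close>

definition KL_I1 :: "real measure \<Rightarrow> (real \<Rightarrow> real) \<Rightarrow> real" where
  "KL_I1 \<mu> L = (\<integral>x. L x \<partial>\<mu>)"

definition KL_I0 :: "real measure \<Rightarrow> (real \<Rightarrow> real) \<Rightarrow> real" where
  "KL_I0 \<nu> L = - (\<integral>x. L x \<partial>\<nu>)"

definition llr_model :: "real measure \<Rightarrow> real measure \<Rightarrow> (real \<Rightarrow> real) \<Rightarrow> bool" where
  "llr_model \<mu> \<nu> L \<longleftrightarrow>
     prob_space \<mu> \<and> prob_space \<nu> \<and> sets \<mu> = sets borel \<and> sets \<nu> = sets borel \<and>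
     L \<in> borel_measurable borel \<and>
     \<mu> = density \<nu> (\<lambda>x. ennreal (exp (L x))) \<and>
     integrable \<mu> L \<and> integrable \<nu> L \<and> 0 < KL_I0 \<nu> L \<and> 0 < KL_I1 \<mu> L"

text \<open>X i k = true observation of sensor i at time k (sensors 1..s, times k \<ge> 1),
  all independent with law \<rho>.\<close>

definition sensor_model :: "'a measure \<Rightarrow> real measure \<Rightarrow> nat \<Rightarrow> (nat \<Rightarrow> nat \<Rightarrow> 'a \<Rightarrow> real) \<Rightarrow> bool" where
  "sensor_model M \<rho> s X \<longleftrightarrow>
     prob_space M \<and>
     prob_space.indep_vars M (\<lambda>_. borel) (\<lambda>p. X (fst p) (snd p)) ({1..s} \<times> {1..}) \<and>
     (\<forall>i\<in>{1..s}. \<forall>k\<ge>1. distr M borel (X i k) = \<rho>)"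

text \<open>An admissible attack: injected values A i k vanish outside the compromised set C,
  and A i k is a measurable function of the true observations of the compromised sensors
  up to time k and of an independent randomisation U (dependence on the previously
  injected values is subsumed, since those are themselves such functions).\<close>

definition admissible_attack ::
  "'a measure \<Rightarrow> 'u measure \<Rightarrow> nat \<Rightarrow> nat set \<Rightarrow> (nat \<Rightarrow> nat \<Rightarrow> 'a \<Rightarrow> real) \<Rightarrow> ('a \<Rightarrow> 'u)
     \<Rightarrow> (nat \<Rightarrow> nat \<Rightarrow> 'a \<Rightarrow> real) \<Rightarrow> bool" where
  "admissible_attack M N s C X U A \<longleftrightarrow>
     C \<subseteq> {1..s} \<and> U \<in> measurable M N \<and>
     prob_space.indep_set M {U -` E \<inter> space M | E. E \<in> sets N}
        {(\<lambda>\<omega>. \<lambda>p\<in>{1..s} \<times> {1..}. X (fst p) (snd p) \<omega>) -` E \<inter> space M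
          | E. E \<in> sets (PiM ({1..s} \<times> {1..}) (\<lambda>_. borel :: real measure))} \<and>
     (\<forall>i k. i \<notin> C \<longrightarrow> (\<forall>\<omega>\<in>space M. A i k \<omega> = 0)) \<and>
     (\<forall>i\<in>C. \<forall>k\<ge>1. \<exists>h \<in> borel_measurable (PiM (C \<times> {1..k}) (\<lambda>_. borel) \<Otimes>\<^sub>M N).
        \<forall>\<omega>\<in>space M. A i k \<omega> = h (\<lambda>p\<in>C \<times> {1..k}. X (fst p) (snd p) \<omega>, U \<omega>))"

text \<open>x i k : (manipulated) observation of sensor i at time k.\<close>

definition llr_sum :: "(real \<Rightarrow> real) \<Rightarrow> (nat \<Rightarrow> nat \<Rightarrow> real) \<Rightarrow> nat \<Rightarrow> nat \<Rightarrow> real" where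
  "llr_sum L x i n = (\<Sum>k\<in>{1..n}. L (x i k))"

definition first_hit :: "(nat \<Rightarrow> bool) \<Rightarrow> enat" where
  "first_hit P = (if \<exists>k. P k then enat (LEAST k. P k) else \<infinity>)"

definition tau_plus :: "(real \<Rightarrow> real) \<Rightarrow> (nat \<Rightarrow> nat \<Rightarrow> real) \<Rightarrow> nat \<Rightarrow> real \<Rightarrow> enat" where
  "tau_plus L x i b = first_hit (\<lambda>k. 1 \<le> k \<and> b \<le> llr_sum L x i k)"

definition tau_minus :: "(real \<Rightarrow> real) \<Rightarrow> (nat \<Rightarrow> nat \<Rightarrow> real) \<Rightarrow> nat \<Rightarrow> real \<Rightarrow> enat" where
  "tau_minus L x i a = first_hit (\<lambda>k. 1 \<le> k \<and> llr_sum L x i k \<le> - a)"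

definition order_stat :: "nat \<Rightarrow> nat \<Rightarrow> (nat \<Rightarrow> enat) \<Rightarrow> enat" where
  "order_stat s j t = sort (map t [1..<Suc s]) ! (j - 1)"

definition vote_minus :: "nat \<Rightarrow> nat \<Rightarrow> (real \<Rightarrow> real) \<Rightarrow> (nat \<Rightarrow> nat \<Rightarrow> real) \<Rightarrow> real \<Rightarrow> enat" where
  "vote_minus s r L x a = order_stat s r (\<lambda>i. tau_minus L x i a)"

definition vote_plus :: "nat \<Rightarrow> nat \<Rightarrow> (real \<Rightarrow> real) \<Rightarrow> (nat \<Rightarrow> nat \<Rightarrow> real) \<Rightarrow> real \<Rightarrow> enat" where
  "vote_plus s r L x b = order_stat s r (\<lambda>i. tau_plus L x i b)"

definition vote_stop :: "nat \<Rightarrow> nat \<Rightarrow> (real \<Rightarrow> real) \<Rightarrow> (nat \<Rightarrow> nat \<Rightarrow> real) \<Rightarrow> real \<Rightarrow> enat" where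
  "vote_stop s r L x b = min (vote_minus s r L x b) (vote_plus s r L x b)"

text \<open>Probability of deciding 1 (resp. 0); ties are broken by an independent fair coin.\<close>
definition vote_prob_dec1 :: "'a measure \<Rightarrow> nat \<Rightarrow> nat \<Rightarrow> (real \<Rightarrow> real) \<Rightarrow> ('a \<Rightarrow> nat \<Rightarrow> nat \<Rightarrow> real) \<Rightarrow> real \<Rightarrow> real" where
  "vote_prob_dec1 M s r L x b =
     measure M {\<omega> \<in> space M. vote_plus s r L (x \<omega>) b < vote_minus s r L (x \<omega>) b}
     + 1/2 * measure M {\<omega> \<in> space M. vote_plus s r L (x \<omega>) b = vote_minus s r L (x \<omega>) b
                                        \<and> vote_plus s r L (x \<omega>) b \<noteq> \<infinity>}"

definition vote_prob_dec0 :: "'a measure \<Rightarrow> nat \<Rightarrow> nat \<Rightarrow> (real \<Rightarrow> real) \<Rightarrow> ('a \<Rightarrow> nat \<Rightarrow> nat \<Rightarrow> real) \<Rightarrow> real \<Rightarrow> real" where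
  "vote_prob_dec0 M s r L x b =
     measure M {\<omega> \<in> space M. vote_minus s r L (x \<omega>) b < vote_plus s r L (x \<omega>) b}
     + 1/2 * measure M {\<omega> \<in> space M. vote_plus s r L (x \<omega>) b = vote_minus s r L (x \<omega>) b
                                        \<and> vote_plus s r L (x \<omega>) b \<noteq> \<infinity>}"

definition vote_exp_stop :: "'a measure \<Rightarrow> nat \<Rightarrow> nat \<Rightarrow> (real \<Rightarrow> real) \<Rightarrow> ('a \<Rightarrow> nat \<Rightarrow> nat \<Rightarrow> real) \<Rightarrow> real \<Rightarrow> ennreal" where
  "vote_exp_stop M s r L x b = (\<integral>\<^sup>+\<omega>. ennreal_of_enat (vote_stop s r L (x \<omega>) b) \<partial>M)"

definition log_inv :: "real \<Rightarrow> ereal" where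
  "log_inv p = (if p \<le> 0 then \<infinity> else ereal (ln (1 / p)))"

text \<open>Asymptotic performance of the voting rule f^(r) as the common threshold a = b \<rightarrow> \<infinity>,
  with D = max over \<theta> of E[T]; we take the liminf of log(1/err)/D, err being the
  worse of the two error probabilities (ratio = 0 if D = \<infinity>).\<close>
definition vote_perf :: "'a measure \<Rightarrow> 'a measure \<Rightarrow> nat \<Rightarrow> nat \<Rightarrow> (real \<Rightarrow> real)
     \<Rightarrow> ('a \<Rightarrow> nat \<Rightarrow> nat \<Rightarrow> real) \<Rightarrow> ('a \<Rightarrow> nat \<Rightarrow> nat \<Rightarrow> real) \<Rightarrow> ereal" where
  "vote_perf M0 M1 s r L x0 x1 =
     Liminf at_top (\<lambda>b::real.
       let D = enn2ereal (max (vote_exp_stop M0 s r L x0 b) (vote_exp_stop M1 s r L x1 b))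
       in min (log_inv (vote_prob_dec1 M0 s r L x0 b) / D)
              (log_inv (vote_prob_dec0 M1 s r L x1 b) / D))"

end

theory Submission
  imports Defs
begin

text \<open>
  Exchanging \<open>L\<close> and \<open>- L\<close> swaps the two hypotheses, so it suffices to study one law \<open>\<rho>\<close> and a
  statistic \<open>l\<close> with negative mean \<open>- J\<close> and \<open>\<integral> exp l = 1\<close>. Let \<open>\<psi> t = \<integral> exp (t l)\<close>.
  A Chernoff bound gives \<open>P (S\<^sub>i n \<ge> b) \<le> exp (- t b) \<psi> t ^ n\<close> for \<open>0 < t \<le> 1\<close>, and it controls
  both sides of the performance ratio.

  Since \<open>\<psi> t < 1\<close> for \<open>0 < t < 1\<close>, summing over \<open>n\<close> bounds the probability that an honest sensor
  ever crosses the wrong threshold by a multiple of \<open>exp (- t b)\<close>. A wrong decision with \<open>r\<close> votes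
  needs \<open>r - c\<close> independent honest sensors to do so, hence has probability of order
  \<open>exp (- t (r - c) b)\<close> for every \<open>t < 1\<close>.

  Since \<open>\<psi>\<close> has right derivative \<open>- J\<close> at \<open>0\<close>, some \<open>t\<close> satisfies \<open>\<psi> t \<le> exp (- t \<eta> J)\<close> for given
  \<open>\<eta> < 1\<close>. After time \<open>b / (\<eta> J)\<close> the probability that some honest sensor is still above \<open>- b\<close>
  then decays geometrically at a rate independent of \<open>b\<close>; as the honest sensors alone reach the
  quorum, the expected delay is at most \<open>b / (\<eta> J)\<close> plus a constant. Let \<open>b\<close> tend to infinity
  and then \<open>t\<close> and \<open>\<eta>\<close> to \<open>1\<close>.
\<close>

section \<open>Order statistics\<close>

text \<open>In a sorted list the entries at most \<open>m\<close> form an initial segment, so the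
  entry at index \<open>r - 1\<close> lies in it exactly when the segment has length at least
  \<open>r\<close>; sorting does not change the count.\<close>

lemma order_stat_le_iff:
  assumes "1 \<le> r" "r \<le> s"
  shows "order_stat s r t \<le> m \<longleftrightarrow> r \<le> card {i \<in> {1..s}. t i \<le> m}"
proof -
  let ?ys = "map t [1..<Suc s]"
  let ?xs = "sort ?ys"
  let ?S = "{i. i < s \<and> ?xs ! i \<le> m}"
  have len: "length ?xs = s" by simp
  have "card ?S = length (filter (\<lambda>x. x \<le> m) ?xs)"
    by (simp add: length_filter_conv_card)
  also have "\<dots> = length (filter (\<lambda>x. x \<le> m) ?ys)"
    by (metis mset_filter mset_sort size_mset)
  also have "\<dots> = card {i \<in> {1..s}. t i \<le> m}"
  proof -
    have "length (filter (\<lambda>x. x \<le> m) ?ys) = length (filter (\<lambda>i. t i \<le> m) [1..<Suc s])"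
      by (simp add: filter_map comp_def)
    also have "\<dots> = card (set (filter (\<lambda>i. t i \<le> m) [1..<Suc s]))"
      by (rule distinct_card[symmetric]) simp
    also have "set (filter (\<lambda>i. t i \<le> m) [1..<Suc s]) = {i \<in> {1..s}. t i \<le> m}"
      by auto
    finally show ?thesis .
  qed
  finally have card: "card ?S = card {i \<in> {1..s}. t i \<le> m}" .
  have "?xs ! (r - 1) \<le> m \<longleftrightarrow> r \<le> card ?S"
  proof
    assume le: "?xs ! (r - 1) \<le> m"
    have "{..<r} \<subseteq> ?S"
    proof
      fix i assume "i \<in> {..<r}"
      then have i: "i \<le> r - 1" "r - 1 < length ?xs" using assms len by auto
      then have "?xs ! i \<le> ?xs ! (r - 1)"
        by (intro sorted_nth_mono) auto
      with le i len show "i \<in> ?S" by auto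
    qed
    then have "card {..<r} \<le> card ?S" by (intro card_mono) auto
    then show "r \<le> card ?S" by simp
  next
    assume r: "r \<le> card ?S"
    show "?xs ! (r - 1) \<le> m"
    proof (rule ccontr)
      assume gt: "\<not> ?xs ! (r - 1) \<le> m"
      have "?S \<subseteq> {..<r - 1}"
      proof
        fix i assume i: "i \<in> ?S"
        show "i \<in> {..<r - 1}"
        proof (rule ccontr)
          assume "i \<notin> {..<r - 1}"
          then have "?xs ! (r - 1) \<le> ?xs ! i"
            using i len by (intro sorted_nth_mono) auto
          with gt i show False by auto
        qed
      qed
      then have "card ?S \<le> card {..<r - 1}" by (intro card_mono) auto
      with r assms show False by simp
    qed
  qed
  then show ?thesis
    by (simp only: order_stat_def card)
qed

lemma order_stat_finite_imp_card:
  assumes "1 \<le> r" "r \<le> s" "order_stat s r t \<noteq> \<infinity>"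
  shows "r \<le> card {i \<in> {1..s}. t i \<noteq> \<infinity>}"
proof -
  \<comment> \<open>The level is the order statistic itself; every entry below a finite level is
    finite.\<close>
  have "r \<le> card {i \<in> {1..s}. t i \<le> order_stat s r t}"
    using assms order_stat_le_iff by blast
  also have "\<dots> \<le> card {i \<in> {1..s}. t i \<noteq> \<infinity>}"
    using assms by (intro card_mono) (auto simp: enat_ile)
  finally show ?thesis .
qed

lemma first_hit_le: "P k \<Longrightarrow> first_hit P \<le> enat k"
  unfolding first_hit_def by (auto intro: Least_le)

lemma first_hit_finite_iff: "first_hit P \<noteq> \<infinity> \<longleftrightarrow> (\<exists>k. P k)"
  unfolding first_hit_def by auto

section \<open>Exponential moments of the log-likelihood ratio\<close>

lemma exp_convex_combination:
  fixes x t :: real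
  assumes "0 \<le> t" "t \<le> 1"
  shows "exp (t * x) \<le> 1 - t + t * exp x"
proof -
  have "exp ((1 - t) *\<^sub>R 0 + t *\<^sub>R x) \<le> (1 - t) * exp 0 + t * exp x"
    using assms by (intro convex_onD[OF exp_convex]) auto
  then show ?thesis by simp
qed

lemma exp_convex_combination_strict:
  fixes x t :: real
  assumes t: "0 < t" "t < 1" and "x \<noteq> 0"
  shows "exp (t * x) < 1 - t + t * exp x"
proof -
  have strict: "1 + y < exp y" if "y \<noteq> 0" for y :: real
  proof -
    have "exp y \<noteq> 1 + y" using ln_eq_minus_one[of "exp y"] that by auto
    with exp_ge_add_one_self[of y] show ?thesis by linarith
  qed
  \<comment> \<open>The two points are chosen so that the tangents, averaged with weights
    \<open>1 - t\<close> and \<open>t\<close>, give exactly 1; multiplying by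
    \<open>exp (t * x)\<close> then produces the chord.\<close>
  have a: "1 - t * x < exp (- t * x)" using strict[of "- t * x"] t \<open>x \<noteq> 0\<close> by simp
  have b: "1 + (1 - t) * x < exp ((1 - t) * x)" using strict[of "(1 - t) * x"] t \<open>x \<noteq> 0\<close> by simp
  have "1 = (1 - t) * (1 - t * x) + t * (1 + (1 - t) * x)" by (simp add: algebra_simps)
  also have "\<dots> < (1 - t) * exp (- t * x) + t * exp ((1 - t) * x)"
    using a b t by (intro add_strict_mono mult_strict_left_mono) auto
  finally have "exp (t * x) * 1 < exp (t * x) * ((1 - t) * exp (- t * x) + t * exp ((1 - t) * x))"
    by (intro mult_strict_left_mono) auto
  also have "\<dots> = 1 - t + t * exp x"
    by (simp add: algebra_simps flip: exp_add)
  finally show ?thesis by simp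
qed

text \<open>One observation under one hypothesis, with the sign of the log-likelihood ratio chosen
  so that decision 1 is always the wrong one. The unit integral of \<open>exp (l x)\<close> makes it
  a likelihood ratio.\<close>

locale neg_drift_llr = prob_space \<rho> for \<rho> :: "real measure" +
  fixes l :: "real \<Rightarrow> real"
  assumes sets_rho [measurable_cong]: "sets \<rho> = sets borel"
    and l_measurable [measurable]: "l \<in> borel_measurable borel"
    and l_integrable: "integrable \<rho> l"
    and neg_drift: "(\<integral>x. l x \<partial>\<rho>) < 0"
    and exp_l_integrable: "integrable \<rho> (\<lambda>x. exp (l x))"
    and exp_l_integral: "(\<integral>x. exp (l x) \<partial>\<rho>) = 1"
begin

definition mgf :: "real \<Rightarrow> real" where
  "mgf t = (\<integral>x. exp (t * l x) \<partial>\<rho>)"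

lemma exp_t_integrable:
  assumes "0 \<le> t" "t \<le> 1"
  shows "integrable \<rho> (\<lambda>x. exp (t * l x))"
proof (rule Bochner_Integration.integrable_bound)
  show "integrable \<rho> (\<lambda>x. 1 - t + t * exp (l x))"
    using exp_l_integrable by simp
  show "AE x in \<rho>. norm (exp (t * l x)) \<le> norm (1 - t + t * exp (l x))"
    using exp_convex_combination[OF assms] by (intro AE_I2) (auto intro: order_trans[OF _ abs_ge_self])
qed measurable

lemma mgf_nonneg: "0 \<le> mgf t"
  unfolding mgf_def by (intro integral_nonneg_AE) simp

text \<open>Equality in the integrated convexity bound would force \<open>l = 0\<close> almost
  everywhere, against the negative drift.\<close>

lemma mgf_less_one:
  assumes t: "0 < t" "t < 1"
  shows "mgf t < 1"
proof (rule ccontr)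
  assume not: "\<not> mgf t < 1"
  let ?f = "\<lambda>x. 1 - t + t * exp (l x) - exp (t * l x)"
  have int: "integrable \<rho> ?f"
    using exp_l_integrable exp_t_integrable[of t] t by simp
  have nonneg: "0 \<le> ?f x" for x using exp_convex_combination[of t "l x"] t by simp
  have "(\<integral>x. ?f x \<partial>\<rho>) = 1 - mgf t"
    using exp_l_integrable exp_t_integrable[of t] t exp_l_integral
    by (simp add: mgf_def prob_space)
  moreover have "0 \<le> (\<integral>x. ?f x \<partial>\<rho>)" by (intro integral_nonneg_AE AE_I2 nonneg)
  ultimately have "(\<integral>x. ?f x \<partial>\<rho>) = 0" using not by simp
  then have "AE x in \<rho>. ?f x = 0"
    using integral_nonneg_eq_0_iff_AE[OF int] nonneg by simp
  then have "AE x in \<rho>. l x = 0"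
    by eventually_elim (use exp_convex_combination_strict[OF t] in force)
  then have "(\<integral>x. l x \<partial>\<rho>) = (\<integral>x. 0 \<partial>\<rho>)" by (intro integral_cong_AE) auto
  with neg_drift show False by simp
qed

text \<open>The derivative at 0 passes under the integral by dominated convergence. It is taken
  along a sequence, from which a single small \<open>t\<close> is extracted later.\<close>

lemma mgf_right_derivative:
  "(\<lambda>n. (mgf (1 / real (Suc n)) - 1) * real (Suc n)) \<longlonglongrightarrow> (\<integral>x. l x \<partial>\<rho>)"
proof -
  let ?t = "\<lambda>n. 1 / real (Suc n)"
  let ?g = "\<lambda>n x. (exp (?t n * l x) - 1) / ?t n"
  have t: "0 < ?t n" "?t n \<le> 1" for n by auto
  have lim: "(\<lambda>n. ?g n x) \<longlonglongrightarrow> l x" for x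
  proof -
    have "((\<lambda>h. exp (h * l x)) has_real_derivative exp (0 * l x) * l x) (at 0)"
      by (auto intro!: derivative_eq_intros)
    then have "((\<lambda>h. (exp (h * l x) - 1) / h) \<longlongrightarrow> l x) (at 0)"
      by (simp add: DERIV_def)
    moreover have "filterlim ?t (at 0) sequentially"
      by (intro filterlim_atI LIMSEQ_Suc[OF lim_1_over_n]) auto
    ultimately show ?thesis by (rule filterlim_compose)
  qed
  \<comment> \<open>The tangent at 0 bounds the quotient below by \<open>l x\<close>, the chord over
    the unit interval bounds it above by \<open>exp (l x) - 1\<close>, both uniformly in
    \<open>n\<close>.\<close>
  have bound: "norm (?g n x) \<le> \<bar>l x\<bar> + exp (l x) + 1" for n x
  proof -
    have "?t n * l x \<le> exp (?t n * l x) - 1" using exp_ge_add_one_self[of "?t n * l x"] by linarith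
    then have lower: "l x \<le> ?g n x" by (simp add: field_simps)
    have "exp (?t n * l x) - 1 \<le> ?t n * (exp (l x) - 1)"
      using exp_convex_combination[of "?t n" "l x"] by (simp add: algebra_simps diff_divide_distrib)
    then have upper: "?g n x \<le> exp (l x) - 1"
      by (subst pos_divide_le_eq[OF t(1)]) (simp only: mult.commute)
    have "0 < exp (l x)" by simp
    with lower upper show ?thesis unfolding real_norm_def by linarith
  qed
  have "(\<lambda>n. \<integral>x. ?g n x \<partial>\<rho>) \<longlonglongrightarrow> (\<integral>x. l x \<partial>\<rho>)"
  proof (rule integral_dominated_convergence)
    show "integrable \<rho> (\<lambda>x. \<bar>l x\<bar> + exp (l x) + 1)"
      using l_integrable exp_l_integrable by simp
    show "AE x in \<rho>. (\<lambda>n. ?g n x) \<longlonglongrightarrow> l x" by (simp only: lim AE_I2)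
    show "\<And>n. AE x in \<rho>. norm (?g n x) \<le> \<bar>l x\<bar> + exp (l x) + 1" by (simp only: bound AE_I2)
  qed measurable
  moreover have "(\<integral>x. ?g n x \<partial>\<rho>) = (mgf (?t n) - 1) * real (Suc n)" for n
    using exp_t_integrable[of "?t n"] t[of n] by (simp add: mgf_def prob_space)
  ultimately show ?thesis by simp
qed

lemma mgf_le_exp:
  assumes "\<eta> < 1"
  obtains t where "0 < t" "t \<le> 1" "mgf t \<le> exp (t * (\<eta> * (\<integral>x. l x \<partial>\<rho>)))"
proof -
  let ?d = "\<integral>x. l x \<partial>\<rho>"
  \<comment> \<open>Multiplying the negative drift by \<open>\<eta> < 1\<close> moves it strictly
    above the derivative, which leaves room for a linear bound at some small
    \<open>t\<close>.\<close>
  have "?d < \<eta> * ?d" using assms neg_drift by (simp add: mult_less_cancel_right1)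
  then have "\<forall>\<^sub>F n in sequentially. (mgf (1 / real (Suc n)) - 1) * real (Suc n) < \<eta> * ?d"
    by (rule order_tendstoD(2)[OF mgf_right_derivative])
  then obtain n where n: "(mgf (1 / real (Suc n)) - 1) * real (Suc n) < \<eta> * ?d"
    by (auto simp: eventually_sequentially)
  let ?t = "1 / real (Suc n)"
  have "mgf ?t \<le> 1 + ?t * (\<eta> * ?d)" using n by (simp add: field_simps)
  also have "\<dots> \<le> exp (?t * (\<eta> * ?d))" by (rule exp_ge_add_one_self)
  finally show ?thesis by (intro that[of ?t]) auto
qed

section \<open>Large deviations of the sensor statistics\<close>

context
  fixes M :: "'a measure" and s :: nat and X :: "nat \<Rightarrow> nat \<Rightarrow> 'a \<Rightarrow> real"
  assumes sensors: "sensor_model M \<rho> s X"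
begin

interpretation P: prob_space M
  using sensors by (simp add: sensor_model_def)

lemma indep_observations:
  "P.indep_vars (\<lambda>_. borel) (\<lambda>p. X (fst p) (snd p)) ({1..s} \<times> {1..})"
  using sensors by (simp add: sensor_model_def)

lemma observation_measurable:
  assumes "i \<in> {1..s}" "1 \<le> k"
  shows "X i k \<in> borel_measurable M"
  using indep_observations assms by (force simp: P.indep_vars_def)

lemma llr_sum_measurable:
  assumes "i \<in> {1..s}"
  shows "(\<lambda>\<omega>. llr_sum l (\<lambda>i k. X i k \<omega>) i n) \<in> borel_measurable M"
  unfolding llr_sum_def
  using assms
  by (intro borel_measurable_sum measurable_compose[OF observation_measurable l_measurable]) auto

text \<open>Chernoff's bound; independence over time factorises the exponential moment. The level
  takes both signs: \<open>b\<close> for wrong crossings, \<open>- b\<close> for the delay.\<close>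

lemma llr_sum_tail:
  assumes i: "i \<in> {1..s}" and t: "0 < t" "t \<le> 1"
  shows "P.prob {\<omega> \<in> space M. a \<le> llr_sum l (\<lambda>i k. X i k \<omega>) i n} \<le> exp (- t * a) * mgf t ^ n"
proof -
  let ?K = "Pair i ` {1..n}"
  let ?Y = "\<lambda>p \<omega>. exp (t * l (X (fst p) (snd p) \<omega>))"
  have "P.indep_vars (\<lambda>_. borel) (\<lambda>p. X (fst p) (snd p)) ?K"
    by (rule P.indep_vars_subset[OF indep_observations]) (use i in auto)
  then have indep: "P.indep_vars (\<lambda>_. borel) ?Y ?K"
    by (rule P.indep_vars_compose2[where Y="\<lambda>_ x. exp (t * l x)"]) simp
  have law: "distr M borel (X i k) = \<rho>" if "1 \<le> k" for k
    using sensors i that by (simp add: sensor_model_def)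
  have int: "integrable M (?Y p)" and exp: "P.expectation (?Y p) = mgf t" if "p \<in> ?K" for p
  proof -
    from that obtain k where p: "p = (i, k)" "1 \<le> k" by auto
    note [measurable] = observation_measurable[OF i \<open>1 \<le> k\<close>]
    have "integrable (distr M borel (X i k)) (\<lambda>x. exp (t * l x))"
      using exp_t_integrable[of t] t law[OF \<open>1 \<le> k\<close>] by simp
    then show "integrable M (?Y p)" using p by (subst (asm) integrable_distr_eq) auto
    have "mgf t = (\<integral>x. exp (t * l x) \<partial>distr M borel (X i k))"
      using law[OF \<open>1 \<le> k\<close>] by (simp add: mgf_def)
    then show "P.expectation (?Y p) = mgf t" using p by (simp add: integral_distr)
  qed
  have prod: "exp (t * llr_sum l (\<lambda>i k. X i k \<omega>) i n) = (\<Prod>p\<in>?K. ?Y p \<omega>)" for \<omega>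
    by (simp add: llr_sum_def sum_distrib_left exp_sum prod.reindex inj_on_def)
  have integrable: "integrable M (\<lambda>\<omega>. exp (t * llr_sum l (\<lambda>i k. X i k \<omega>) i n))"
    unfolding prod by (rule P.indep_vars_integrable[OF _ indep int]) auto
  have "P.expectation (\<lambda>\<omega>. exp (t * llr_sum l (\<lambda>i k. X i k \<omega>) i n)) = (\<Prod>p\<in>?K. P.expectation (?Y p))"
    unfolding prod by (rule P.indep_vars_lebesgue_integral[OF _ indep int]) auto
  also have "\<dots> = mgf t ^ n"
    by (simp add: exp card_image inj_on_def)
  finally have expectation: "P.expectation (\<lambda>\<omega>. exp (t * llr_sum l (\<lambda>i k. X i k \<omega>) i n)) = mgf t ^ n" .
  have ind: "indicator (space M) \<omega> *\<^sub>R exp (t * llr_sum l (\<lambda>i k. X i k \<omega>) i n)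
      = exp (t * llr_sum l (\<lambda>i k. X i k \<omega>) i n)" if "\<omega> \<in> space M" for \<omega>
    using that by simp
  show ?thesis
    using P.Chernoff_ineq_ge[OF t(1), of "space M" "\<lambda>\<omega>. llr_sum l (\<lambda>i k. X i k \<omega>) i n" a]
      integrable expectation
    by (simp add: set_integrable_def set_lebesgue_integral_def ind
        cong: Bochner_Integration.integrable_cong Bochner_Integration.integral_cong)
qed

text \<open>A union bound over all times; \<open>t < 1\<close> makes the geometric series converge,
  whereas \<open>mgf 1 = 1\<close>.\<close>

lemma crossing_probability:
  assumes i: "i \<in> {1..s}" and t: "0 < t" "t < 1"
  shows "P.prob {\<omega> \<in> space M. \<exists>n. b \<le> llr_sum l (\<lambda>i k. X i k \<omega>) i n} \<le> exp (- t * b) / (1 - mgf t)"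
proof -
  let ?A = "\<lambda>n. {\<omega> \<in> space M. b \<le> llr_sum l (\<lambda>i k. X i k \<omega>) i n}"
  note [measurable] = llr_sum_measurable[OF i]
  have norm: "norm (mgf t) < 1" using mgf_nonneg mgf_less_one[OF t] by simp
  have tail: "P.prob (?A n) \<le> exp (- t * b) * mgf t ^ n" for n
    using llr_sum_tail[OF i, of t] t by simp
  have summable: "summable (\<lambda>n. exp (- t * b) * mgf t ^ n)"
    by (intro summable_mult summable_geometric norm)
  have summable_A: "summable (\<lambda>n. P.prob (?A n))"
    by (rule summable_comparison_test[OF _ summable]) (use tail in auto)
  have "{\<omega> \<in> space M. \<exists>n. b \<le> llr_sum l (\<lambda>i k. X i k \<omega>) i n} = (\<Union>n. ?A n)" by auto
  then have "P.prob {\<omega> \<in> space M. \<exists>n. b \<le> llr_sum l (\<lambda>i k. X i k \<omega>) i n} \<le> (\<Sum>n. P.prob (?A n))"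
    using P.finite_measure_subadditive_countably[of ?A] summable_A by (simp add: image_subset_iff)
  also have "\<dots> \<le> (\<Sum>n. exp (- t * b) * mgf t ^ n)"
    by (intro suminf_le tail summable summable_A)
  also have "\<dots> = exp (- t * b) / (1 - mgf t)"
    by (simp only: suminf_mult[OF summable_geometric[OF norm]] suminf_geometric[OF norm]) simp
  finally show ?thesis .
qed

lemma joint_crossing_probability:
  assumes J: "J \<subseteq> {1..s}" and t: "0 < t" "t < 1"
  shows "P.prob {\<omega> \<in> space M. \<forall>i\<in>J. \<exists>n. b \<le> llr_sum l (\<lambda>i k. X i k \<omega>) i n}
    \<le> (exp (- t * b) / (1 - mgf t)) ^ card J"
proof (cases "J = {}")
  \<comment> \<open>Independence is applied to a nonempty index set; for the empty one the bound is
    1.\<close>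
  case False
  have fin: "finite J" using J finite_subset by blast
  \<comment> \<open>The observations are grouped into disjoint rows, one per sensor, so whole
    trajectories are independent and each crossing is an event of a single row.\<close>
  let ?K = "\<lambda>i. {i} \<times> {1::nat..}"
  let ?Z = "\<lambda>i \<omega>. restrict (\<lambda>p. X (fst p) (snd p) \<omega>) (?K i)"
  let ?F = "\<lambda>i. {y \<in> space (PiM (?K i) (\<lambda>_. borel)). \<exists>n. b \<le> (\<Sum>k\<in>{1..n}. l (y (i, k)))}"
  have indep: "P.indep_vars (\<lambda>i. PiM (?K i) (\<lambda>_. borel)) ?Z J"
    by (rule P.indep_vars_restrict[OF indep_observations])
      (use J in \<open>auto simp: disjoint_family_on_def\<close>)
  have F: "?F i \<in> sets (PiM (?K i) (\<lambda>_. borel))" for i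
  proof -
    have "(\<lambda>y. \<Sum>k\<in>{1..n}. l (y (i, k))) \<in> borel_measurable (PiM (?K i) (\<lambda>_. borel))" for n
      by (intro borel_measurable_sum measurable_compose[OF _ l_measurable] measurable_component_singleton) auto
    then show ?thesis by measurable
  qed
  have preimage: "?Z i -` ?F i \<inter> space M = {\<omega> \<in> space M. \<exists>n. b \<le> llr_sum l (\<lambda>i k. X i k \<omega>) i n}" for i
    by (auto simp: llr_sum_def space_PiM)
  have "{\<omega> \<in> space M. \<forall>i\<in>J. \<exists>n. b \<le> llr_sum l (\<lambda>i k. X i k \<omega>) i n} = (\<Inter>i\<in>J. ?Z i -` ?F i \<inter> space M)"
    unfolding preimage using False by auto
  then have "P.prob {\<omega> \<in> space M. \<forall>i\<in>J. \<exists>n. b \<le> llr_sum l (\<lambda>i k. X i k \<omega>) i n}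
      = (\<Prod>i\<in>J. P.prob (?Z i -` ?F i \<inter> space M))"
    using P.indep_varsD[OF indep False fin order_refl, of ?F] F by simp
  also have "\<dots> \<le> (\<Prod>i\<in>J. exp (- t * b) / (1 - mgf t))"
    unfolding preimage using J crossing_probability[OF _ t] by (intro prod_mono) auto
  finally show ?thesis by simp
qed simp

section \<open>The voting rule under attack\<close>

text \<open>\<open>x\<close> is the received data, tied to the true observations at the honest
  sensors; the bounds are worst-case over its values at the sensors in \<open>C\<close>. The upper
  bound on \<open>r\<close> lets the honest sensors form a quorum alone.\<close>

context
  fixes C :: "nat set" and r :: nat and x :: "'a \<Rightarrow> nat \<Rightarrow> nat \<Rightarrow> real"
  assumes C: "C \<subseteq> {1..s}" and r: "1 \<le> r" "r \<le> s - card C"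
    and honest: "\<And>\<omega> i k. \<omega> \<in> space M \<Longrightarrow> i \<in> {1..s} - C \<Longrightarrow> x \<omega> i k = X i k \<omega>"
begin

lemma r_le_s: "r \<le> s"
  using r by simp

lemma finite_C: "finite C"
  using C finite_subset by blast

lemma llr_sum_honest:
  "\<omega> \<in> space M \<Longrightarrow> i \<in> {1..s} - C \<Longrightarrow> llr_sum l (x \<omega>) i n = llr_sum l (\<lambda>i k. X i k \<omega>) i n"
  unfolding llr_sum_def by (simp add: honest)

text \<open>Among \<open>r\<close> sensors above \<open>b\<close> at most \<open>card C\<close> are
  compromised, so some \<open>r - card C\<close> honest ones have crossed; a union bound runs over
  the finitely many such subsets, whose number does not depend on \<open>b\<close>.\<close>

lemma vote_error_bound:
  assumes t: "0 < t" "t < 1"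
  obtains K where "0 < K"
    "\<And>b. vote_prob_dec1 M s r l x b \<le> K * exp (- (t * b * real (r - card C)))"
proof -
  let ?m = "r - card C"
  let ?JJ = "{J. J \<subseteq> {1..s} - C \<and> card J = ?m}"
  let ?B = "\<lambda>b J. {\<omega> \<in> space M. \<forall>i\<in>J. \<exists>n. b \<le> llr_sum l (\<lambda>i k. X i k \<omega>) i n}"
  let ?E = "\<lambda>b. \<Union>J\<in>?JJ. ?B b J"
  \<comment> \<open>The factor 2 covers the wrong decision and the tie, each contained in
    \<open>?E b\<close>; the added 1 makes positivity immediate.\<close>
  let ?K = "2 * ((real (card ?JJ) + 1) * (1 / (1 - mgf t)) ^ ?m)"
  have fin: "finite ?JJ" by (rule finite_subset[of _ "Pow {1..s}"]) auto
  have meas: "?B b J \<in> sets M" if "J \<in> ?JJ" for b J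
  proof -
    from that have "finite J" using finite_subset by blast
    moreover have "i \<in> {1..s}" if "i \<in> J" for i using that \<open>J \<in> ?JJ\<close> by auto
    note llr_sum_measurable[OF this, measurable]
    ultimately show ?thesis by measurable
  qed
  have in_E: "\<omega> \<in> ?E b" if \<omega>: "\<omega> \<in> space M" and hit: "vote_plus s r l (x \<omega>) b \<noteq> \<infinity>" for \<omega> b
  proof -
    let ?S = "{i \<in> {1..s}. tau_plus l (x \<omega>) i b \<noteq> \<infinity>}"
    have "r \<le> card ?S"
      using order_stat_finite_imp_card[OF r(1) r_le_s] hit by (simp add: vote_plus_def)
    then have "?m \<le> card (?S - C)"
      using diff_card_le_card_Diff[OF finite_C, of ?S] by linarith
    then obtain J where J: "J \<subseteq> ?S - C" "card J = ?m"
      by (rule obtain_subset_with_card_n) auto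
    have "\<exists>n. b \<le> llr_sum l (\<lambda>i k. X i k \<omega>) i n" if "i \<in> J" for i
    proof -
      have i: "i \<in> {1..s} - C" "tau_plus l (x \<omega>) i b \<noteq> \<infinity>" using that J by auto
      then obtain n where "b \<le> llr_sum l (x \<omega>) i n"
        unfolding tau_plus_def first_hit_finite_iff by blast
      then show ?thesis using llr_sum_honest[OF \<omega> i(1)] by auto
    qed
    with J \<omega> show ?thesis by blast
  qed
  have "vote_prob_dec1 M s r l x b \<le> ?K * exp (- (t * b * real ?m))" for b
  proof -
    have E: "?E b \<in> sets M" using fin meas by (intro sets.finite_UN) auto
    \<comment> \<open>Monotonicity of the measure rests on the measurability of the larger event
      \<open>?E b\<close>, which involves honest data only.\<close>
    have "P.prob {\<omega> \<in> space M. vote_plus s r l (x \<omega>) b < vote_minus s r l (x \<omega>) b} \<le> P.prob (?E b)"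
      by (rule P.finite_measure_mono[OF _ E], rule subsetI, rule in_E) (simp_all del: not_infinity_eq, metis enat_ord_simps(6))
    moreover have "P.prob {\<omega> \<in> space M. vote_plus s r l (x \<omega>) b = vote_minus s r l (x \<omega>) b
        \<and> vote_plus s r l (x \<omega>) b \<noteq> \<infinity>} \<le> P.prob (?E b)"
      by (rule P.finite_measure_mono[OF _ E], rule subsetI, rule in_E) blast+
    moreover have "0 \<le> P.prob (?E b)" by simp
    ultimately have "vote_prob_dec1 M s r l x b \<le> 2 * P.prob (?E b)"
      unfolding vote_prob_dec1_def by linarith
    also have "P.prob (?E b) \<le> (\<Sum>J\<in>?JJ. P.prob (?B b J))"
      using fin meas by (intro P.finite_measure_subadditive_finite) auto
    also have "\<dots> \<le> (\<Sum>J\<in>?JJ. (exp (- t * b) / (1 - mgf t)) ^ ?m)"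
    proof (rule sum_mono)
      fix J assume "J \<in> ?JJ"
      then show "P.prob (?B b J) \<le> (exp (- t * b) / (1 - mgf t)) ^ ?m"
        using joint_crossing_probability[OF _ t, of J b] by auto
    qed
    also have "\<dots> = real (card ?JJ) * (exp (- t * b) / (1 - mgf t)) ^ ?m" by simp
    also have "\<dots> \<le> (real (card ?JJ) + 1) * (exp (- t * b) / (1 - mgf t)) ^ ?m"
      using mgf_less_one[OF t] by (intro mult_right_mono zero_le_power) auto
    also have "(exp (- t * b) / (1 - mgf t)) ^ ?m = (1 / (1 - mgf t)) ^ ?m * exp (- (t * b * real ?m))"
      by (simp add: power_divide mult.commute flip: exp_of_nat_mult)
    finally show ?thesis by (simp only: mult.assoc)
  qed
  moreover have "0 < ?K" using mgf_less_one[OF t] by (intro mult_pos_pos zero_less_power) auto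
  ultimately show ?thesis by (rule that[rotated])
qed

text \<open>The honest sensors number at least \<open>r\<close>, so once all of them are at or below
  \<open>- b\<close> they complete the vote for 0, whatever the others report.\<close>

lemma vote_stop_le:
  assumes \<omega>: "\<omega> \<in> space M" and n: "1 \<le> n"
    and below: "\<And>i. i \<in> {1..s} - C \<Longrightarrow> llr_sum l (\<lambda>i k. X i k \<omega>) i n \<le> - b"
  shows "vote_stop s r l (x \<omega>) b \<le> enat n"
proof -
  have "tau_minus l (x \<omega>) i b \<le> enat n" if i: "i \<in> {1..s} - C" for i
    unfolding tau_minus_def using below[OF i] llr_sum_honest[OF \<omega> i] n by (intro first_hit_le) simp
  then have "{1..s} - C \<subseteq> {i \<in> {1..s}. tau_minus l (x \<omega>) i b \<le> enat n}" by auto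
  then have "card ({1..s} - C) \<le> card {i \<in> {1..s}. tau_minus l (x \<omega>) i b \<le> enat n}"
    by (intro card_mono) auto
  moreover have "card ({1..s} - C) = s - card C" using C by (simp add: card_Diff_subset finite_C)
  ultimately have "vote_minus s r l (x \<omega>) b \<le> enat n"
    unfolding vote_minus_def using r by (subst order_stat_le_iff[OF r(1) r_le_s]) linarith
  then show ?thesis unfolding vote_stop_def by (simp add: min.coboundedI1)
qed

lemma vote_delay_bound:
  assumes \<eta>: "0 < \<eta>" "\<eta> < 1"
  obtains K where "0 \<le> K"
    "\<And>b. 0 < b \<Longrightarrow> vote_exp_stop M s r l x b \<le> ennreal (b / (\<eta> * - (\<integral>x. l x \<partial>\<rho>)) + K)"
proof -
  let ?v = "\<eta> * - (\<integral>x. l x \<partial>\<rho>)"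
  let ?H = "{1..s} - C"
  have v: "0 < ?v" using \<eta> neg_drift by (intro mult_pos_pos) auto
  obtain t where t: "0 < t" "t \<le> 1" and mgf: "mgf t \<le> exp (- (t * ?v))"
    using mgf_le_exp[OF \<eta>(2)] by auto
  let ?q = "exp (- (t * ?v))"
  have q: "0 < ?q" "?q < 1" using mult_pos_pos[OF t(1) v] by auto
  \<comment> \<open>The 1 pays for rounding \<open>b / ?v\<close> up to an integer, the fraction for
    a geometric tail over at most \<open>s\<close> honest sensors.\<close>
  let ?K = "1 + real s / (1 - ?q)"
  have "vote_exp_stop M s r l x b \<le> ennreal (b / ?v + ?K)" if b: "0 < b" for b
  proof -
    \<comment> \<open>The first integer time by which a path with the reduced drift
      \<open>- ?v\<close> has reached \<open>- b\<close>; \<open>1 \<le> n0\<close> matters because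
      hitting times count from 1.\<close>
    define n0 where "n0 = nat \<lceil>b / ?v\<rceil>"
    have bv: "0 < b / ?v" using b v by (rule divide_pos_pos)
    have n0: "b / ?v \<le> real n0" "real n0 \<le> b / ?v + 1" "1 \<le> n0"
      using bv unfolding n0_def by linarith+
    let ?A = "\<lambda>i n. {\<omega> \<in> space M. - b \<le> llr_sum l (\<lambda>i k. X i k \<omega>) i n}"
    \<comment> \<open>\<open>?g n\<close> dominates the indicator of stopping after time
      \<open>n\<close>: trivially before \<open>n0\<close>, then by the number of honest sensors
      still at or above \<open>- b\<close>. \<open>?h n\<close> will bound its integral.\<close>
    let ?g = "\<lambda>n \<omega>. if n < n0 then 1 else (\<Sum>i\<in>?H. indicator (?A i n) \<omega>) :: ennreal"
    let ?h = "\<lambda>n. if n < n0 then 1 else real s * ?q ^ (n - n0)"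
    have A: "?A i n \<in> sets M" if "i \<in> ?H" for i n
    proof -
      from that have "i \<in> {1..s}" by simp
      note [measurable] = llr_sum_measurable[OF this]
      show ?thesis by measurable
    qed
    have stop_le: "ennreal_of_enat (vote_stop s r l (x \<omega>) b) \<le> (\<Sum>n. ?g n \<omega>)" if \<omega>: "\<omega> \<in> space M" for \<omega>
    proof -
      let ?T = "vote_stop s r l (x \<omega>) b"
      \<comment> \<open>The delay is written as the number of \<open>n\<close> below it, which also
        covers an infinite delay.\<close>
      have "(\<lambda>n::nat. if enat n < ?T then 1 else 0) sums ennreal_of_enat ?T"
        using sums_If_finite[of "\<lambda>n. enat n < ?T" "\<lambda>_. 1 :: ennreal"]
        by (cases ?T) (simp_all add: sums_def of_nat_tendsto_top_ennreal)
      then have "ennreal_of_enat ?T = (\<Sum>n. if enat n < ?T then 1 else 0)"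
        by (simp add: sums_iff)
      also have "\<dots> \<le> (\<Sum>n. ?g n \<omega>)"
      proof (intro suminf_le summableI)
        fix n
        show "(if enat n < ?T then 1 else 0) \<le> ?g n \<omega>"
        proof (cases "enat n < ?T \<and> n0 \<le> n")
          case True
          then have "1 \<le> n" using n0 by linarith
          from True have "\<not> (\<forall>i\<in>?H. llr_sum l (\<lambda>i k. X i k \<omega>) i n \<le> - b)"
            using vote_stop_le[OF \<omega> \<open>1 \<le> n\<close>, of b] by (meson leD)
          then obtain i where i: "i \<in> ?H" "- b \<le> llr_sum l (\<lambda>i k. X i k \<omega>) i n" by force
          have "(1::ennreal) = indicator (?A i n) \<omega>" using i \<omega> by simp
          also have "\<dots> \<le> (\<Sum>i\<in>?H. indicator (?A i n) \<omega>)"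
            by (rule member_le_sum[OF i(1)]) auto
          finally show ?thesis using True by simp
        qed auto
      qed
      finally show ?thesis .
    qed
    have "vote_exp_stop M s r l x b \<le> (\<integral>\<^sup>+\<omega>. (\<Sum>n. ?g n \<omega>) \<partial>M)"
      unfolding vote_exp_stop_def by (rule nn_integral_mono) (rule stop_le)
    also have "\<dots> = (\<Sum>n. \<integral>\<^sup>+\<omega>. ?g n \<omega> \<partial>M)"
      by (rule nn_integral_suminf) (use A in simp)
    also have "\<dots> \<le> (\<Sum>n. ennreal (?h n))"
    proof (intro suminf_le summableI)
      fix n
      show "(\<integral>\<^sup>+\<omega>. ?g n \<omega> \<partial>M) \<le> ennreal (?h n)"
      proof (cases "n < n0")
        case False
        have "exp (t * b) * mgf t ^ n \<le> exp (t * b) * ?q ^ n"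
          by (intro mult_left_mono power_mono mgf mgf_nonneg) simp
        also have "\<dots> = (exp (t * b) * ?q ^ n0) * ?q ^ (n - n0)"
          using False by (simp flip: power_add)
        \<comment> \<open>By time \<open>n0\<close> the factor \<open>?q ^ n0\<close> has
          compensated \<open>exp (t * b)\<close>, so the remaining decay does not depend on
          \<open>b\<close>.\<close>
        also have "\<dots> \<le> 1 * ?q ^ (n - n0)"
        proof (rule mult_right_mono)
          have "b \<le> real n0 * ?v" using n0(1) unfolding pos_divide_le_eq[OF v] .
          then have "t * b \<le> t * (real n0 * ?v)" using t by (intro mult_left_mono) auto
          then have "exp (t * b + real n0 * (- (t * ?v))) \<le> 1" by (simp add: algebra_simps)
          then show "exp (t * b) * ?q ^ n0 \<le> 1" by (simp only: exp_add exp_of_nat_mult)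
        qed simp
        finally have decay: "exp (t * b) * mgf t ^ n \<le> ?q ^ (n - n0)" by simp
        have "P.prob (?A i n) \<le> ?q ^ (n - n0)" if "i \<in> ?H" for i
          using llr_sum_tail[OF _ t, of i "- b" n] that decay by auto
        then have "(\<Sum>i\<in>?H. P.prob (?A i n)) \<le> real (card ?H) * ?q ^ (n - n0)"
          by (rule sum_bounded_above)
        also have "\<dots> \<le> real s * ?q ^ (n - n0)"
          using card_mono[of "{1..s}" ?H] by (intro mult_right_mono) auto
        finally have sum_le: "(\<Sum>i\<in>?H. P.prob (?A i n)) \<le> real s * ?q ^ (n - n0)" .
        have "(\<integral>\<^sup>+\<omega>. ?g n \<omega> \<partial>M) = (\<Sum>i\<in>?H. emeasure M (?A i n))"
        proof -
          have "(\<integral>\<^sup>+\<omega>. ?g n \<omega> \<partial>M) = (\<integral>\<^sup>+\<omega>. (\<Sum>i\<in>?H. indicator (?A i n) \<omega>) \<partial>M)"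
            using False by simp
          also have "\<dots> = (\<Sum>i\<in>?H. \<integral>\<^sup>+\<omega>. indicator (?A i n) \<omega> \<partial>M)"
            by (rule nn_integral_sum) (rule borel_measurable_indicator[OF A])
          also have "\<dots> = (\<Sum>i\<in>?H. emeasure M (?A i n))"
            by (intro sum.cong refl nn_integral_indicator A)
          finally show ?thesis .
        qed
        also have "\<dots> = ennreal (\<Sum>i\<in>?H. P.prob (?A i n))"
          by (simp add: P.emeasure_eq_measure)
        finally show ?thesis using sum_le False by (simp add: ennreal_leI)
      qed (simp add: P.emeasure_space_1)
    qed
    also have "\<dots> = ennreal (real n0 + real s / (1 - ?q))"
    proof -
      have "(\<lambda>n. real s * ?q ^ n) sums (real s * (1 / (1 - ?q)))"
        using q by (intro sums_mult geometric_sums) simp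
      then have "?h sums (real s * (1 / (1 - ?q)) + (\<Sum>n<n0. ?h n))"
        by (subst sums_iff_shift[symmetric]) simp
      then have sums: "?h sums (real n0 + real s / (1 - ?q))" by (simp add: add.commute)
      show ?thesis
        using sums q by (subst suminf_ennreal2) (auto simp: sums_iff)
    qed
    also have "\<dots> \<le> ennreal (b / ?v + ?K)" using n0 by (intro ennreal_leI) linarith
    finally show ?thesis .
  qed
  moreover have "0 \<le> ?K" using q by simp
  ultimately show ?thesis by (rule that[rotated])
qed

end

end

end

section \<open>Asymptotic performance\<close>

lemma llr_sum_uminus: "llr_sum (\<lambda>x. - l x) x i n = - llr_sum l x i n"
  by (simp add: llr_sum_def sum_negf)

lemma vote_plus_uminus: "vote_plus s r (\<lambda>x. - l x) x b = vote_minus s r l x b"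
  by (simp add: vote_plus_def vote_minus_def tau_plus_def tau_minus_def llr_sum_uminus le_minus_iff)

lemma vote_minus_uminus: "vote_minus s r (\<lambda>x. - l x) x b = vote_plus s r l x b"
  by (simp add: vote_plus_def vote_minus_def tau_plus_def tau_minus_def llr_sum_uminus)

lemma vote_prob_dec1_uminus:
  "vote_prob_dec1 M s r (\<lambda>x. - l x) x b = vote_prob_dec0 M s r l x b"
proof -
  have "{\<omega> \<in> space M. vote_minus s r l (x \<omega>) b = vote_plus s r l (x \<omega>) b \<and> vote_minus s r l (x \<omega>) b \<noteq> \<infinity>} =
    {\<omega> \<in> space M. vote_plus s r l (x \<omega>) b = vote_minus s r l (x \<omega>) b \<and> vote_plus s r l (x \<omega>) b \<noteq> \<infinity>}"
    by (rule Collect_cong) metis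
  then show ?thesis
    by (simp only: vote_prob_dec1_def vote_prob_dec0_def vote_plus_uminus vote_minus_uminus)
qed

lemma vote_exp_stop_uminus:
  "vote_exp_stop M s r (\<lambda>x. - l x) x b = vote_exp_stop M s r l x b"
  by (simp add: vote_exp_stop_def vote_stop_def vote_plus_uminus vote_minus_uminus min.commute)

section \<open>The two hypotheses as likelihood ratios with negative drift\<close>

lemma llr_model_null:
  assumes "llr_model \<mu> \<nu> L"
  shows "neg_drift_llr \<nu> L"
proof -
  interpret nu: prob_space \<nu> using assms by (simp add: llr_model_def)
  interpret mu: prob_space \<mu> using assms unfolding llr_model_def by blast
  have [measurable_cong]: "sets \<nu> = sets borel" and [measurable]: "L \<in> borel_measurable borel"
    and mu: "\<mu> = density \<nu> (\<lambda>x. ennreal (exp (L x)))"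
    using assms by (auto simp: llr_model_def)
  \<comment> \<open>The unit integral is the total mass of \<open>\<mu>\<close>, read through its
    density.\<close>
  have "(\<integral>\<^sup>+x. ennreal (exp (L x)) \<partial>\<nu>) = emeasure \<mu> (space \<mu>)"
    unfolding mu by (subst emeasure_density) (auto intro!: nn_integral_cong)
  then have "(\<integral>\<^sup>+x. ennreal (exp (L x)) \<partial>\<nu>) = ennreal 1" using mu.emeasure_space_1 by simp
  then have "has_bochner_integral \<nu> (\<lambda>x. exp (L x)) 1"
    by (intro has_bochner_integral_nn_integral) auto
  then show ?thesis
    using assms by unfold_locales
      (auto simp: llr_model_def KL_I0_def has_bochner_integral_iff)
qed

lemma llr_model_alternative:
  assumes "llr_model \<mu> \<nu> L"
  shows "neg_drift_llr \<mu> (\<lambda>x. - L x)"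
proof -
  interpret nu: prob_space \<nu> using assms by (simp add: llr_model_def)
  interpret mu: prob_space \<mu> using assms unfolding llr_model_def by blast
  have [measurable_cong]: "sets \<nu> = sets borel" and [measurable]: "L \<in> borel_measurable borel"
    and mu: "\<mu> = density \<nu> (\<lambda>x. ennreal (exp (L x)))"
    using assms by (auto simp: llr_model_def)
  \<comment> \<open>Under the change of measure to \<open>\<nu>\<close> the density
    \<open>exp (L x)\<close> cancels the integrand.\<close>
  have "integrable \<mu> (\<lambda>x. exp (- L x))"
    unfolding mu by (subst integrable_real_density) (auto simp flip: exp_add)
  moreover have "(\<integral>x. exp (- L x) \<partial>\<mu>) = 1"
    unfolding mu by (subst integral_real_density) (auto simp: nu.prob_space simp flip: exp_add)
  ultimately show ?thesis
    using assms by unfold_locales (auto simp: llr_model_def KL_I1_def)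
qed

text \<open>Joins an error bound and a delay bound into a bound on their ratio. The condition
  \<open>ln K \<le> e\<close> keeps the numerator nonnegative, so enlarging the inverse delay
  enlarges the product; the extended reals also cover \<open>p \<le> 0\<close> and
  \<open>D = 0\<close>.\<close>

lemma log_inv_ratio_bound:
  assumes p: "p \<le> K * exp (- e)" and K: "0 < K" and D: "D \<le> ennreal B" and B: "0 < B"
    and e: "ln K \<le> e"
  shows "ereal ((e - ln K) / B) \<le> log_inv p / enn2ereal D"
proof -
  have num: "ereal (e - ln K) \<le> log_inv p"
  proof (cases "0 < p")
    case True
    then have "ln p \<le> ln (K * exp (- e))" using p K by (subst ln_le_cancel_iff) auto
    also have "\<dots> = ln K - e" using K by (simp add: ln_mult)
    finally show ?thesis using True by (simp add: log_inv_def ln_div)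
  qed (simp add: log_inv_def)
  have "enn2ereal D \<le> ereal B"
    using D B by (metis enn2ereal_ennreal enn2ereal_nonneg less_eq_ennreal.rep_eq less_imp_le)
  then have inv: "inverse (ereal B) \<le> inverse (enn2ereal D)"
    by (intro ereal_inverse_antimono) auto
  have "ereal ((e - ln K) / B) = ereal (e - ln K) * inverse (ereal B)"
    using B by (simp add: divide_inverse)
  also have "\<dots> \<le> ereal (e - ln K) * inverse (enn2ereal D)"
    using e inv by (intro ereal_mult_left_mono) auto
  also have "\<dots> \<le> log_inv p * inverse (enn2ereal D)"
    by (intro ereal_mult_right_mono num) (simp add: ereal_inverse_nonneg_iff)
  finally show ?thesis by (simp add: divide_ereal_def)
qed

theorem theorem5:
  fixes \<mu> \<nu> :: "real measure" and L :: "real \<Rightarrow> real"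
    and s cbar :: nat and C :: "nat set"
    and M :: "nat \<Rightarrow> 'a measure" and N :: "nat \<Rightarrow> 'u measure"
    and X A :: "nat \<Rightarrow> nat \<Rightarrow> nat \<Rightarrow> 'a \<Rightarrow> real" and U :: "nat \<Rightarrow> 'a \<Rightarrow> 'u"
  assumes "llr_model \<mu> \<nu> L"
    and "card C \<le> cbar" and "2 * cbar < s"
    and "\<forall>\<theta>\<in>{0,1}. sensor_model (M \<theta>) (if \<theta> = 0 then \<nu> else \<mu>) s (X \<theta>)"
    and "\<forall>\<theta>\<in>{0,1}. admissible_attack (M \<theta>) (N \<theta>) s C (X \<theta>) (U \<theta>) (A \<theta>)"
  shows "vote_perf (M 0) (M 1) s (s - cbar) L
           (\<lambda>\<omega> i k. X 0 i k \<omega> + A 0 i k \<omega>) (\<lambda>\<omega> i k. X 1 i k \<omega> + A 1 i k \<omega>)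
         \<ge> ereal (real (s - cbar - card C) * min (KL_I0 \<nu> L) (KL_I1 \<mu> L))"
proof -
  define I where "I = min (KL_I0 \<nu> L) (KL_I1 \<mu> L)"
  define m where "m = real (s - cbar - card C)"
  let ?r = "s - cbar"
  let ?x = "\<lambda>\<theta> \<omega> i k. X \<theta> i k \<omega> + A \<theta> i k \<omega>"
  let ?D = "\<lambda>b. max (vote_exp_stop (M 0) s ?r L (?x 0) b) (vote_exp_stop (M 1) s ?r L (?x 1) b)"
  let ?R = "\<lambda>b. min (log_inv (vote_prob_dec1 (M 0) s ?r L (?x 0) b) / enn2ereal (?D b))
    (log_inv (vote_prob_dec0 (M 1) s ?r L (?x 1) b) / enn2ereal (?D b))"
  interpret H0: neg_drift_llr \<nu> L using assms(1) by (rule llr_model_null)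
  interpret H1: neg_drift_llr \<mu> "\<lambda>x. - L x" using assms(1) by (rule llr_model_alternative)
  have sensors: "sensor_model (M 0) \<nu> s (X 0)" "sensor_model (M 1) \<mu> s (X 1)"
    using assms(4) by auto
  have C: "C \<subseteq> {1..s}" using assms(5) by (simp add: admissible_attack_def)
  have r: "1 \<le> ?r" "?r \<le> s - card C" using assms by auto
  have honest: "?x \<theta> \<omega> i k = X \<theta> i k \<omega>"
    if "\<theta> \<in> {0, 1}" "\<omega> \<in> space (M \<theta>)" "i \<in> {1..s} - C" for \<theta> \<omega> i k
    using assms(5) that by (auto simp: admissible_attack_def)
  have m: "0 < m" using assms(2,3) by (simp add: m_def)
  have drift: "- (\<integral>x. L x \<partial>\<nu>) = KL_I0 \<nu> L" "- (\<integral>x. - L x \<partial>\<mu>) = KL_I1 \<mu> L"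
    by (simp_all add: KL_I0_def KL_I1_def)
  have I: "0 < I" "I \<le> KL_I0 \<nu> L" "I \<le> KL_I1 \<mu> L"
    using assms(1) by (auto simp: I_def llr_model_def)
  \<comment> \<open>Of the three factors \<open>\<eta>\<close>, one comes from the error exponent,
    one from the delay, and the third leaves a margin \<open>1 - \<eta>\<close> for the additive
    constants.\<close>
  have bound: "ereal (\<eta> ^ 3 * (m * I)) \<le> Liminf at_top ?R" if \<eta>: "0 < \<eta>" "\<eta> < 1" for \<eta>
  proof -
    obtain K0 where K0: "0 < K0"
      "\<And>b. vote_prob_dec1 (M 0) s ?r L (?x 0) b \<le> K0 * exp (- (\<eta> * b * m))"
      using H0.vote_error_bound[OF sensors(1) C r honest \<eta>] by (auto simp: m_def)
    \<comment> \<open>Under \<open>\<mu>\<close> the general bound is applied to \<open>- L\<close>,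
      where wrongly deciding 0 turns into deciding 1.\<close>
    obtain K1 where K1: "0 < K1"
      "\<And>b. vote_prob_dec0 (M 1) s ?r L (?x 1) b \<le> K1 * exp (- (\<eta> * b * m))"
      using H1.vote_error_bound[OF sensors(2) C r honest \<eta>]
      by (auto simp: m_def vote_prob_dec1_uminus)
    obtain B0 where B0: "0 \<le> B0"
      "\<And>b. 0 < b \<Longrightarrow> vote_exp_stop (M 0) s ?r L (?x 0) b \<le> ennreal (b / (\<eta> * KL_I0 \<nu> L) + B0)"
      using H0.vote_delay_bound[OF sensors(1) C r honest \<eta>] unfolding drift by auto
    obtain B1 where B1: "0 \<le> B1"
      "\<And>b. 0 < b \<Longrightarrow> vote_exp_stop (M 1) s ?r L (?x 1) b \<le> ennreal (b / (\<eta> * KL_I1 \<mu> L) + B1)"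
      using H1.vote_delay_bound[OF sensors(2) C r honest \<eta>]
      unfolding drift vote_exp_stop_uminus by auto
    define k where "k = max (ln K0) (ln K1)"
    define B where "B = B0 + B1"
    \<comment> \<open>The three terms secure \<open>0 < b\<close>, a nonnegative numerator
      \<open>\<eta> * b * m - k\<close>, and the absorption of \<open>k\<close> and \<open>B\<close>
      by the margin.\<close>
    define b0 where "b0 = max 1 (max (k / (\<eta> * m)) ((k + B * (\<eta> ^ 3 * (m * I))) / (\<eta> * m * (1 - \<eta>))))"
    have "ereal (\<eta> ^ 3 * (m * I)) \<le> ?R b" if b: "b0 \<le> b" for b
    proof -
      have b_pos: "0 < b" using b by (simp add: b0_def)
      have pos: "0 < \<eta> * m" "0 < \<eta> * m * (1 - \<eta>)" using \<eta> m by auto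
      have "k / (\<eta> * m) \<le> b" using b by (simp add: b0_def)
      then have k_le: "k \<le> \<eta> * b * m" using pos by (simp add: pos_divide_le_eq mult_ac)
      have "(k + B * (\<eta> ^ 3 * (m * I))) / (\<eta> * m * (1 - \<eta>)) \<le> b" using b by (simp add: b0_def)
      then have big: "k + B * (\<eta> ^ 3 * (m * I)) \<le> b * (\<eta> * m * (1 - \<eta>))"
        using pos by (simp add: pos_divide_le_eq)
      let ?B = "b / (\<eta> * I) + B"
      have BB: "0 < ?B" using b_pos \<eta> I B0(1) B1(1) by (simp add: B_def add_pos_nonneg)
      have "\<eta> ^ 3 * (m * I) * ?B = b * (\<eta> * m) * \<eta> + B * (\<eta> ^ 3 * (m * I))"
        using \<eta> I by (simp add: field_simps power3_eq_cube)
      also have "\<dots> \<le> \<eta> * b * m - k" using big by (simp add: algebra_simps)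
      finally have main: "\<eta> ^ 3 * (m * I) \<le> (\<eta> * b * m - k) / ?B"
        using BB by (simp add: pos_le_divide_eq)
      have mono: "b / (\<eta> * J) \<le> b / (\<eta> * I)" if "I \<le> J" for J
        using that b_pos \<eta> I by (intro divide_left_mono mult_left_mono mult_pos_pos) auto
      have D: "?D b \<le> ennreal ?B"
      proof (rule max.boundedI)
        show "vote_exp_stop (M 0) s ?r L (?x 0) b \<le> ennreal ?B"
          by (rule order_trans[OF B0(2)[OF b_pos]])
            (use mono[OF I(2)] B0 B1 in \<open>auto simp: B_def intro!: ennreal_leI\<close>)
        show "vote_exp_stop (M 1) s ?r L (?x 1) b \<le> ennreal ?B"
          by (rule order_trans[OF B1(2)[OF b_pos]])
            (use mono[OF I(3)] B0 B1 in \<open>auto simp: B_def intro!: ennreal_leI\<close>)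
      qed
      have ratio: "ereal (\<eta> ^ 3 * (m * I)) \<le> log_inv p / enn2ereal (?D b)"
        if K: "0 < K" "ln K \<le> k" and p: "p \<le> K * exp (- (\<eta> * b * m))" for p K
      proof -
        have "(\<eta> * b * m - k) / ?B \<le> (\<eta> * b * m - ln K) / ?B"
          using K BB by (intro divide_right_mono) auto
        with main have "ereal (\<eta> ^ 3 * (m * I)) \<le> ereal ((\<eta> * b * m - ln K) / ?B)" by simp
        also have "\<dots> \<le> log_inv p / enn2ereal (?D b)"
          using K k_le by (intro log_inv_ratio_bound[OF p K(1) D BB]) simp
        finally show ?thesis .
      qed
      show ?thesis
        using ratio[OF K0(1) _ K0(2)] ratio[OF K1(1) _ K1(2)] by (simp add: k_def)
    qed
    then show ?thesis
      by (intro Liminf_bounded) (auto simp: eventually_at_top_linorder)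
  qed
  \<comment> \<open>The performance does not involve \<open>\<eta>\<close>, so the bound extends by
    continuity from \<open>\<eta> < 1\<close> to its limit at 1.\<close>
  have "((\<lambda>\<eta>. ereal (\<eta> ^ 3 * (m * I))) \<longlongrightarrow> ereal (1 ^ 3 * (m * I))) (at_left 1)"
    by (intro tendsto_intros)
  moreover have "\<forall>\<^sub>F \<eta> in at_left 1. ereal (\<eta> ^ 3 * (m * I)) \<le> Liminf at_top ?R"
    by (rule eventually_mono[OF eventually_at_left_real[of 0 1]]) (simp, rule bound, simp_all)
  ultimately have "ereal (1 ^ 3 * (m * I)) \<le> Liminf at_top ?R"
    by (rule tendsto_upperbound) simp
  then show ?thesis
    by (simp add: vote_perf_def Let_def m_def I_def)
qed

end
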